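(* Let $n\ge 4$. Then $-4$ is an eigenvalue of $\mathcal{Q}(n)$ with multiplicity $(n-3)^2$, and the family $\mathcal{F}_n=\{X_n^{(a,b)}\mid (a,b)\in[n-3]^2\}$ is a basis of the eigenspace of $\mathcal{Q}(n)$ associated with $-4$.
   Context: The $n$-Queens' graph $\mathcal{Q}(n)$ has vertex set $[n]^2$ (squares $(i,j)$ of an $n\times n$ chessboard); two distinct vertices $(i,j),(p,q)$ are adjacent iff $i=p$, or $j=q$, or $i+j=p+q$, or $i-j=p-q$. Vectors in $\mathbb{R}^{n^2}$ are indexed by $[n]^2$. Let $X_4\in\mathbb{R}^{16}$ be the $4\times4$ array with rows $(0,1,-1,0)$, $(-1,0,0,1)$, $(1,0,0,-1)$, $(0,-1,1,0)$ (i.e. $[X_4]_{(1,2)}=1$, $[X_4]_{(1,3)}=-1$, etc.). For $(a,b)\in[n-3]^2$, with $A=\{a,\dots,a+3\}$ and $B=\{b,\dots,b+3\}$, define $[X_n^{(a,b)}]_{(i,j)}=[X_4]_{(i-a+1,j-b+1)}$ if $(i,j)\in A\times B$ and $0$ otherwise. *)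

theory Defs
  imports
    "Jordan_Normal_Form.Char_Poly"
    "Jordan_Normal_Form.VS_Connect"
begin

type_synonym square = "nat \<times> nat"

text \<open>The squares \<open>[n]\<^sup>2\<close> in row-major order. The list fixes the identification of
  \<open>\<real>\<^bsup>[n]\<^sup>2\<^esup>\<close> with \<open>carrier_vec (n\<^sup>2)\<close> used below.\<close>

definition squares :: "nat \<Rightarrow> square list" where
  "squares n = List.product [1..<Suc n] [1..<Suc n]"

lemma set_squares: "set (squares n) = {1..n} \<times> {1..n}"
  by (auto simp: squares_def)

lemma distinct_squares: "distinct (squares n)"
  by (simp add: squares_def distinct_product)

lemma length_squares: "length (squares n) = n\<^sup>2"
  by (simp add: squares_def power2_eq_square del: upt_Suc)

definition queens_adjacent :: "square \<Rightarrow> square \<Rightarrow> bool" where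
  "queens_adjacent = (\<lambda>(i, j) (p, q). (i, j) \<noteq> (p, q) \<and>
     (i = p \<or> j = q \<or> i + j = p + q \<or> int i - int j = int p - int q))"

definition queens_matrix :: "nat \<Rightarrow> real mat" where
  "queens_matrix n = mat (n\<^sup>2) (n\<^sup>2)
     (\<lambda>(k, l). if queens_adjacent (squares n ! k) (squares n ! l) then 1 else 0)"

definition board_vec :: "nat \<Rightarrow> (square \<Rightarrow> real) \<Rightarrow> real vec" where
  "board_vec n f = vec (n\<^sup>2) (\<lambda>k. f (squares n ! k))"

text \<open>Rows and columns are numbered from 1; only arguments in \<open>{1..4}\<close> are meaningful.\<close>

definition X4 :: "square \<Rightarrow> real" where
  "X4 = (\<lambda>(i, j).
     [[ 0,  1, -1,  0],
      [-1,  0,  0,  1],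
      [ 1,  0,  0, -1],
      [ 0, -1,  1,  0]] ! (i - 1) ! (j - 1))"

definition X :: "nat \<Rightarrow> square \<Rightarrow> real vec" where
  "X n = (\<lambda>(a, b). board_vec n (\<lambda>(i, j).
     if i \<in> {a..a + 3} \<and> j \<in> {b..b + 3} then X4 (i - a + 1, j - b + 1) else 0))"

definition eigenspace :: "real mat \<Rightarrow> real \<Rightarrow> real vec set" where
  "eigenspace A c = {v \<in> carrier_vec (dim_row A). A *\<^sub>v v = c \<cdot>\<^sub>v v}"

abbreviation eigenspace_module :: "real mat \<Rightarrow> real \<Rightarrow> (real, real vec) module" where
  "eigenspace_module A c \<equiv> module_vec TYPE(real) (dim_row A) \<lparr>carrier := eigenspace A c\<rparr>"

text \<open>The unfolding rules of \<open>vectorspace.basis\<close> and \<open>vectorspace.dim\<close> are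
  conditional on this fact.\<close>

lemma vectorspace_eigenspace:
  assumes A: "A \<in> carrier_mat m m"
  shows "vectorspace class_ring (eigenspace_module A c)"
proof -
  interpret vec_space "TYPE(real)" m .
  have dim: "dim_row A = m" using A by simp
  have smult: "A *\<^sub>v (r \<cdot>\<^sub>v v) = c \<cdot>\<^sub>v (r \<cdot>\<^sub>v v)"
    if "v \<in> carrier_vec m" "A *\<^sub>v v = c \<cdot>\<^sub>v v" for r v
    using that A by (simp add: mult_mat_vec smult_smult_assoc mult.commute)
  have add: "A *\<^sub>v (u + v) = c \<cdot>\<^sub>v (u + v)"
    if "u \<in> carrier_vec m" "A *\<^sub>v u = c \<cdot>\<^sub>v u" "v \<in> carrier_vec m" "A *\<^sub>v v = c \<cdot>\<^sub>v v" for u v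
    using that A by (simp add: mult_add_distrib_mat_vec smult_add_distrib_vec)
  have zero: "A *\<^sub>v 0\<^sub>v m = c \<cdot>\<^sub>v 0\<^sub>v m" using A by auto
  have "subspace class_ring (eigenspace A c) V"
    unfolding subspace_def
  proof (intro conjI)
    show "vectorspace class_ring V" by unfold_locales
    show "submodule class_ring (eigenspace A c) V"
      by unfold_locales
        (use smult add zero in \<open>auto simp: eigenspace_def dim module_vec_simps\<close>)
  qed
  from subspace_is_vs[OF this] show ?thesis by (simp add: dim)
qed

end

theory Submission
  imports
    Defs
    "Jordan_Normal_Form.Jordan_Normal_Form_Existence"
    "Jordan_Normal_Form.Jordan_Normal_Form_Uniqueness"
begin

text \<open>Every square lies on four lines (row, column, two diagonals), so \<open>queens_matrix n + 4 I\<close> is the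
  sum of \<open>1\<^sub>L 1\<^sub>L\<^sup>T\<close> over all lines \<open>L\<close>. Its quadratic form is the sum of the squared line sums, hence
  the eigenspace for \<open>-4\<close> consists of the boards all of whose line sums vanish. If such a board vanishes
  on its first \<open>m\<close> rows, then both ends of row \<open>m + 1\<close> are alone on a diagonal and vanish too, and the row
  can be cleared by subtracting blocks placed in it. Once only three rows are left, the board is zero,
  column by column. The algebraic multiplicity agrees with the dimension because the matrix is real
  symmetric: its characteristic polynomial splits over the reals and \<open>ker B\<^sup>2 = ker B\<close> for symmetric \<open>B\<close>,
  which rules out Jordan blocks of size two or more.\<close>

section \<open>Boards with vanishing line sums\<close>

text \<open>A line is a level set of one of these four maps, so it is addressed by a pair of a map
  and a value. Values in \<open>int\<close> keep \<open>i - j\<close> from being truncated.\<close>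

definition line_maps :: "(square \<Rightarrow> int) list" where
  "line_maps = [\<lambda>(i, j). int i, \<lambda>(i, j). int j, \<lambda>(i, j). int i + int j, \<lambda>(i, j). int i - int j]"

abbreviation board :: "nat \<Rightarrow> square set" where
  "board n \<equiv> {1..n} \<times> {1..n}"

definition balanced :: "nat \<Rightarrow> (square \<Rightarrow> real) \<Rightarrow> bool" where
  "balanced n f \<longleftrightarrow>
     (\<forall>l\<in>set line_maps. \<forall>k. (\<Sum>t\<in>board n. f t * of_bool (l t = k)) = 0)"

section \<open>Blocks and their line sums\<close>

definition block :: "square \<Rightarrow> square \<Rightarrow> real" where
  "block = (\<lambda>(a, b) (i, j).
     if i \<in> {a..a + 3} \<and> j \<in> {b..b + 3} then X4 (i - a + 1, j - b + 1) else 0)"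

lemma X_eq_block: "X n p = board_vec n (block p)"
  by (simp add: X_def block_def split: prod.split)

lemma four_cases:
  fixes i a :: nat
  assumes "i \<in> {a..a + 3}"
  shows "i = a \<or> i = a + 1 \<or> i = a + 2 \<or> i = a + 3"
  using assms by auto

text \<open>The top row (0, 1, -1, 0) is a difference of two unit vectors: this makes the clearing
  of a row telescope, and the entry 1 serves as pivot for independence.\<close>

lemma block_first_row: "block (a, b) (a, j) = of_bool (j = b + 1) - of_bool (j = b + 2)"
  using four_cases[of j b] by (auto simp: block_def X4_def)

lemma block_nonzero:
  assumes "block (a, b) (i, j) \<noteq> 0"
  shows "a \<le> i" "i \<le> a + 3" "b \<le> j" "j \<le> b + 3"
  using assms by (auto simp: block_def split: if_splits)

lemma block_outside_board:
  assumes "p \<in> board (n - 3)" "t \<notin> board n"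
  shows "block p t = 0"
proof (rule ccontr)
  obtain a b i j where "p = (a, b)" "t = (i, j)" by fastforce
  moreover assume "block p t \<noteq> 0"
  ultimately show False using assms block_nonzero[of a b i j] by auto
qed

text \<open>On every line of \<open>X4\<close> the entries 1 and -1 occur equally often, so for any
  weight depending only on the line the eight nonzero terms cancel in pairs. Later \<open>g\<close>
  is the indicator of a single line.\<close>

lemma X4_weighted_sum:
  assumes "l \<in> set line_maps"
  shows "(\<Sum>(i, j)\<in>{0..3} \<times> {0..3}. X4 (i + 1, j + 1) * g (l (a + i, b + j))) = (0::real)"
proof -
  have four: "{0..3::nat} = {0, 1, 2, 3}" by auto
  have "(\<Sum>(i, j)\<in>{0..3} \<times> {0..3}. X4 (i + 1, j + 1) * g (l (a + i, b + j)))
      = (\<Sum>i\<in>{0, 1, 2, 3}. \<Sum>j\<in>{0, 1, 2, 3}. X4 (i + 1, j + 1) * g (l (a + i, b + j)))"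
    by (simp only: sum.cartesian_product four)
  also have "\<dots> = g (l (a, b + 1)) - g (l (a, b + 2))
      + g (l (a + 1, b + 3)) - g (l (a + 1, b))
      + g (l (a + 2, b)) - g (l (a + 2, b + 3))
      + g (l (a + 3, b + 2)) - g (l (a + 3, b + 1))"
    by (simp add: X4_def)
  also have "\<dots> = 0"
  proof -
    consider "l = (\<lambda>(i, j). int i)" | "l = (\<lambda>(i, j). int j)"
      | "l = (\<lambda>(i, j). int i + int j)" | "l = (\<lambda>(i, j). int i - int j)"
      using assms by (auto simp: line_maps_def)
    then show ?thesis by cases (simp_all add: algebra_simps)
  qed
  finally show ?thesis .
qed

lemma balanced_block:
  assumes p: "p \<in> board (n - 3)"
  shows "balanced n (block p)"
  unfolding balanced_def
proof (intro ballI allI)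
  fix l k assume l: "l \<in> set line_maps"
  obtain a b where ab: "p = (a, b)" by fastforce
  let ?s = "\<lambda>(i, j). (a + i, b + j)"
  have "(\<Sum>t\<in>board n. block p t * of_bool (l t = k))
      = (\<Sum>t\<in>{a..a + 3} \<times> {b..b + 3}. block p t * of_bool (l t = k))"
  proof (rule sum.mono_neutral_right)
    show "{a..a + 3} \<times> {b..b + 3} \<subseteq> board n" using p ab by auto
    show "\<forall>t\<in>board n - {a..a + 3} \<times> {b..b + 3}. block p t * of_bool (l t = k) = 0"
      by (auto simp: ab block_def split: if_splits)
  qed simp
  also have "{a..a + 3} \<times> {b..b + 3} = ?s ` ({0..3} \<times> {0..3})"
  proof -
    have "{c..c + 3} = (+) c ` {0..3}" for c :: nat by (simp add: add.commute)
    then show ?thesis by (simp only: image_paired_Times)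
  qed
  also have "(\<Sum>t\<in>?s ` ({0..3} \<times> {0..3}). block p t * of_bool (l t = k))
      = (\<Sum>(i, j)\<in>{0..3} \<times> {0..3}. X4 (i + 1, j + 1) * of_bool (l (a + i, b + j) = k))"
  proof (subst sum.reindex)
    show "inj_on ?s ({0..3} \<times> {0..3})" by (auto simp: inj_on_def)
    show "sum ((\<lambda>t. block p t * of_bool (l t = k)) \<circ> ?s) ({0..3} \<times> {0..3})
        = (\<Sum>(i, j)\<in>{0..3} \<times> {0..3}. X4 (i + 1, j + 1) * of_bool (l (a + i, b + j) = k))"
      by (rule sum.cong[OF refl]) (auto simp: ab block_def)
  qed
  also have "\<dots> = 0"
    by (rule X4_weighted_sum[OF l, of "\<lambda>x. of_bool (x = k)"])
  finally show "(\<Sum>t\<in>board n. block p t * of_bool (l t = k)) = 0" .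
qed

section \<open>Elimination of a balanced board, row by row\<close>

lemma balanced_diff: "balanced n f \<Longrightarrow> balanced n g \<Longrightarrow> balanced n (\<lambda>t. f t - g t)"
  by (simp add: balanced_def left_diff_distrib sum_subtractf)

lemma balanced_sum:
  assumes "\<And>p. p \<in> P \<Longrightarrow> balanced n (F p)"
  shows "balanced n (\<lambda>t. \<Sum>p\<in>P. c p * F p t)"
  unfolding balanced_def
proof (intro ballI allI)
  fix l k assume "l \<in> set line_maps"
  then have "(\<Sum>p\<in>P. c p * (\<Sum>t\<in>board n. F p t * of_bool (l t = k))) = 0"
    using assms by (intro sum.neutral) (auto simp: balanced_def)
  then show "(\<Sum>t\<in>board n. (\<Sum>p\<in>P. c p * F p t) * of_bool (l t = k)) = 0"
    unfolding sum_distrib_left sum_distrib_right mult.assoc by (subst sum.swap)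
qed

text \<open>The sum over the line of \<open>s\<close> reduces to \<open>f s\<close>. Column and
  diagonal sums enter the elimination only in this form.\<close>

lemma balanced_isolated:
  assumes "balanced n f" "l \<in> set line_maps" "s \<in> board n"
    and other: "\<And>t. t \<in> board n \<Longrightarrow> l t = l s \<Longrightarrow> t \<noteq> s \<Longrightarrow> f t = 0"
  shows "f s = 0"
proof -
  have "0 = (\<Sum>t\<in>board n. f t * of_bool (l t = l s))"
    using assms by (simp add: balanced_def)
  also have "\<dots> = f s + (\<Sum>t\<in>board n - {s}. f t * of_bool (l t = l s))"
    by (subst sum.remove[OF _ assms(3)]) auto
  also have "(\<Sum>t\<in>board n - {s}. f t * of_bool (l t = l s)) = 0"
    using other by (intro sum.neutral) auto
  finally show ?thesis by simp
qed

lemma balanced_row_sum: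
  assumes "balanced n f" "i \<in> {1..n}"
  shows "(\<Sum>j\<in>{1..n}. f (i, j)) = 0"
proof -
  have "(\<lambda>(i, j). int i) \<in> set line_maps" by (simp add: line_maps_def)
  then have "0 = (\<Sum>t\<in>board n. f t * of_bool (int (fst t) = int i))"
    using assms(1) unfolding balanced_def case_prod_unfold by metis
  also have "\<dots> = (\<Sum>i'\<in>{1..n}. \<Sum>j\<in>{1..n}. f (i', j) * of_bool (i' = i))"
    by (simp only: sum.cartesian_product case_prod_unfold prod.collapse of_nat_eq_iff)
  also have "\<dots> = (\<Sum>i'\<in>{1..n}. if i' = i then (\<Sum>j\<in>{1..n}. f (i, j)) else 0)"
    by (intro sum.cong) auto
  also have "\<dots> = (\<Sum>j\<in>{1..n}. f (i, j))"
    using assms(2) by simp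
  finally show ?thesis by simp
qed

text \<open>Columns are cleared from left to right. The antidiagonal through
  \<open>(n - 2, j)\<close> meets only earlier columns and zero rows, the diagonal through
  \<open>(n, j)\<close> only earlier columns; so both squares vanish, and the column sum then kills
  the middle square \<open>(n - 1, j)\<close>.\<close>

lemma balanced_three_rows:
  assumes bal: "balanced n f" and n: "3 \<le> n"
    and outside: "\<And>t. t \<notin> board n \<Longrightarrow> f t = 0"
    and rows: "\<And>i j. i \<le> n - 3 \<Longrightarrow> f (i, j) = 0"
  shows "f t = 0"
proof -
  have "f (i, j) = 0" for i j
  proof (induction j arbitrary: i rule: less_induct)
    case (less j)
    show ?case
    proof (cases "j \<in> {1..n}")
      case False
      then show ?thesis by (intro outside) auto
    next
      case j: True
      have low: "f t = 0" if "fst t \<le> n - 3 \<or> snd t < j" for t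
        using that rows less by (cases t) auto
      have top: "f (n - 2, j) = 0"
      proof (rule balanced_isolated[OF bal, of "\<lambda>(i, j). int i + int j"])
        fix t assume "t \<in> board n" "(case t of (i, j) \<Rightarrow> int i + int j)
            = (case (n - 2, j) of (i, j) \<Rightarrow> int i + int j)" "t \<noteq> (n - 2, j)"
        then show "f t = 0" by (intro low) (auto split: prod.splits)
      qed (use j n in \<open>auto simp: line_maps_def\<close>)
      have bottom: "f (n, j) = 0"
      proof (rule balanced_isolated[OF bal, of "\<lambda>(i, j). int i - int j"])
        fix t assume "t \<in> board n" "(case t of (i, j) \<Rightarrow> int i - int j)
            = (case (n, j) of (i, j) \<Rightarrow> int i - int j)" "t \<noteq> (n, j)"
        then show "f t = 0" by (intro low) (auto split: prod.splits)
      qed (use j n in \<open>auto simp: line_maps_def\<close>)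
      have other: "f (i', j) = 0" if "i' \<noteq> n - 1" for i'
      proof -
        have "i' \<le> n - 3 \<or> i' = n - 2 \<or> i' = n \<or> i' > n"
          using that by linarith
        then consider "i' \<le> n - 3" | "i' = n - 2" | "i' = n" | "i' > n"
          by blast
        then show ?thesis
          by cases (use rows top bottom outside[of "(i', j)"] in auto)
      qed
      have "f (n - 1, j) = 0"
      proof (rule balanced_isolated[OF bal, of "\<lambda>(i, j). int j"])
        fix t assume "(case t of (i, j) \<Rightarrow> int j) = (case (n - 1, j) of (i, j) \<Rightarrow> int j)"
          "t \<noteq> (n - 1, j)"
        then show "f t = 0" by (cases t) (auto intro!: other)
      qed (use j n in \<open>auto simp: line_maps_def\<close>)
      then show ?thesis using other by (cases "i = n - 1") auto
    qed
  qed
  then show ?thesis by (cases t) auto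
qed

text \<open>The coefficients are the partial sums of row \<open>a\<close>. At column
  \<open>j\<close> only the blocks at \<open>b = j - 1\<close> and \<open>b = j - 2\<close>
  contribute, with opposite signs, and the difference of their partial sums is
  \<open>f (a, j)\<close>.\<close>

lemma balanced_first_row:
  assumes bal: "balanced n f" and n: "4 \<le> n" and a: "a \<in> {1..n}"
    and rows: "\<And>i j. i < a \<Longrightarrow> f (i, j) = 0"
    and j: "j \<in> {1..n}"
  shows "f (a, j) = (\<Sum>b\<in>{1..n - 3}. (\<Sum>k\<in>{1..b + 1}. f (a, k)) * block (a, b) (a, j))"
proof -
  let ?D = "\<lambda>b. \<Sum>k\<in>{1..b + 1}. f (a, k)"
  \<comment> \<open>All other squares on the antidiagonal of \<open>(a, 1)\<close> lie above row
    \<open>a\<close>; the same holds for the diagonal of \<open>(a, n)\<close>.\<close>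
  have left: "f (a, 1) = 0"
  proof (rule balanced_isolated[OF bal, of "\<lambda>(i, j). int i + int j"])
    fix t assume "t \<in> board n" "(case t of (i, j) \<Rightarrow> int i + int j)
        = (case (a, 1) of (i, j) \<Rightarrow> int i + int j)" "t \<noteq> (a, 1)"
    then show "f t = 0" by (cases t) (auto intro!: rows)
  qed (use a n in \<open>auto simp: line_maps_def\<close>)
  have right: "f (a, n) = 0"
  proof (rule balanced_isolated[OF bal, of "\<lambda>(i, j). int i - int j"])
    fix t assume "t \<in> board n" "(case t of (i, j) \<Rightarrow> int i - int j)
        = (case (a, n) of (i, j) \<Rightarrow> int i - int j)" "t \<noteq> (a, n)"
    then show "f t = 0" by (cases t) (auto intro!: rows)
  qed (use a n in \<open>auto simp: line_maps_def\<close>)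
  \<comment> \<open>Columns 2 and \<open>n - 1\<close> call for the partial sums at 0 and
    \<open>n - 2\<close>, for which there is no block; both of these are zero.\<close>
  have D0: "?D 0 = 0" using left by simp
  have D_last: "?D (n - 2) = 0"
  proof -
    have "{1..n} = insert n {1..n - 2 + 1}" using n by auto
    then show ?thesis using balanced_row_sum[OF bal a] right n by simp
  qed
  \<comment> \<open>As \<open>b\<close> is at least 1, truncated subtraction is safe:
    \<open>b = j - 1\<close> and \<open>b = j - 2\<close> mean \<open>j = b + 1\<close> and
    \<open>j = b + 2\<close>.\<close>
  have "(\<Sum>b\<in>{1..n - 3}. D b * block (a, b) (a, j))
      = (\<Sum>b\<in>{1..n - 3}. if b = j - 1 then D b else 0)
        - (\<Sum>b\<in>{1..n - 3}. if b = j - 2 then D b else 0)" for D :: "nat \<Rightarrow> real"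
    unfolding sum_subtractf[symmetric] block_first_row
    by (intro sum.cong) auto
  then have "(\<Sum>b\<in>{1..n - 3}. ?D b * block (a, b) (a, j))
      = (\<Sum>b\<in>{1..n - 3}. if b = j - 1 then ?D b else 0)
        - (\<Sum>b\<in>{1..n - 3}. if b = j - 2 then ?D b else 0)" .
  also have "\<dots> = (if j - 1 \<in> {1..n - 3} then ?D (j - 1) else 0)
      - (if j - 2 \<in> {1..n - 3} then ?D (j - 2) else 0)"
    by (simp only: sum.delta' sum.delta finite_atLeastAtMost)
  also have "\<dots> = f (a, j)"
  proof -
    consider "j = 1" | "j = n" | "2 \<le> j" "j \<le> n - 1" using j by force
    then show ?thesis
    proof cases
      case 3
      have "(if j - 1 \<in> {1..n - 3} then ?D (j - 1) else 0) = ?D (j - 1)"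
      proof (cases "j = n - 1")
        case True
        then have "j - 1 = n - 2" using n by simp
        then show ?thesis using D_last by simp
      qed (use 3 in auto)
      moreover have "(if j - 2 \<in> {1..n - 3} then ?D (j - 2) else 0) = ?D (j - 2)"
      proof (cases "j = 2")
        case True
        then show ?thesis using D0 by simp
      qed (use 3 in auto)
      moreover have "?D (j - 1) = f (a, j) + ?D (j - 2)"
      proof -
        have "{1..j - 1 + 1} = insert j {1..j - 2 + 1}" using 3 by auto
        then have "?D (j - 1) = sum (\<lambda>k. f (a, k)) (insert j {1..j - 2 + 1})" by (simp only:)
        also have "\<dots> = f (a, j) + ?D (j - 2)" by (rule sum.insert) (use 3 in auto)
        finally show ?thesis .
      qed
      ultimately show ?thesis by (simp only: add_diff_cancel_right')
    qed (use left right n in auto)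
  qed
  finally show ?thesis by simp
qed

text \<open>Induction on the number \<open>n - 3 - m\<close> of rows still to be cleared.
  Subtracting the blocks with top row \<open>m + 1\<close> clears that row and leaves the rows above
  it untouched, since a block is zero above its top row. At \<open>m = n - 3\<close> the three
  remaining rows vanish by \<open>balanced_three_rows\<close>.\<close>

lemma balanced_combination:
  assumes "balanced n f" "4 \<le> n"
    and "\<And>t. t \<notin> board n \<Longrightarrow> f t = 0"
    and "m \<le> n - 3" "\<And>i j. i \<le> m \<Longrightarrow> f (i, j) = 0"
  shows "\<exists>c. \<forall>t. f t = (\<Sum>p\<in>board (n - 3). c p * block p t)"
  using assms(1, 3-5)
proof (induction "n - 3 - m" arbitrary: m f)
  case 0
  have "f t = 0" for t
  proof (rule balanced_three_rows[OF "0.prems"(1) _ "0.prems"(2)])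
    show "f (i, j) = 0" if "i \<le> n - 3" for i j
      using that "0.hyps" by (intro "0.prems"(4)) linarith
  qed (use assms(2) in auto)
  then show ?case by (intro exI[of _ "\<lambda>_. 0"]) simp
next
  case step: (Suc d)
  note f = step.prems(1) and rows = step.prems(4)
  define a where "a = Suc m"
  have a: "a \<in> {1..n - 3}" using step.hyps(2) by (auto simp: a_def)
  define D where "D b = (\<Sum>k\<in>{1..b + 1}. f (a, k))" for b
  define r where "r t = (\<Sum>b\<in>{1..n - 3}. D b * block (a, b) t)" for t
  define g where "g t = f t - r t" for t
  have outside: "g t = 0" if "t \<notin> board n" for t
    unfolding g_def r_def
    using step.prems(2)[OF that] block_outside_board[OF _ that] a
    by (auto intro!: sum.neutral)
  have "balanced n g"
    unfolding g_def[abs_def] r_def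
    using a by (intro balanced_diff balanced_sum balanced_block f) auto
  moreover have "g (i, j) = 0" if "i \<le> Suc m" for i j
  proof (cases "i = a \<and> j \<in> {1..n}")
    case True
    then show ?thesis
      using balanced_first_row[OF f assms(2) _ rows, of a j] a
      by (simp add: g_def r_def D_def a_def)
  next
    case False
    then have "i < a \<or> j \<notin> {1..n}" using that by (auto simp: a_def)
    then consider "i < a" | "j \<notin> {1..n}" by blast
    then show ?thesis
    proof cases
      case 1
      then have "r (i, j) = 0"
        unfolding r_def using block_nonzero(1)[of a _ i j] by (intro sum.neutral) force
      then show ?thesis using rows[of i j] 1 by (simp add: g_def a_def)
    qed (auto intro: outside)
  qed
  moreover have "d = n - 3 - Suc m" "Suc m \<le> n - 3" using step.hyps(2) by auto
  ultimately obtain c where c: "g t = (\<Sum>p\<in>board (n - 3). c p * block p t)" for t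
    using step.hyps(1)[of "Suc m" g] outside by blast
  \<comment> \<open>The coefficients of row \<open>a\<close> are extended by 0 to all blocks, so
    that they can be added to those of \<open>g\<close>.\<close>
  have "r t = (\<Sum>p\<in>board (n - 3). (if fst p = a then D (snd p) else 0) * block p t)" for t
  proof -
    have "(\<Sum>p\<in>board (n - 3). (if fst p = a then D (snd p) else 0) * block p t)
        = (\<Sum>i\<in>{1..n - 3}. \<Sum>b\<in>{1..n - 3}. (if i = a then D b else 0) * block (i, b) t)"
      by (simp only: sum.cartesian_product case_prod_unfold prod.collapse)
    also have "\<dots> = (\<Sum>i\<in>{1..n - 3}. if i = a then r t else 0)"
      by (intro sum.cong) (auto simp: r_def)
    also have "\<dots> = r t" using a by simp
    finally show ?thesis by simp
  qed
  then have "f t = (\<Sum>p\<in>board (n - 3).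
      (c p + (if fst p = a then D (snd p) else 0)) * block p t)" for t
    using c[of t] unfolding g_def distrib_right sum.distrib by simp
  then show ?case by (intro exI allI)
qed

text \<open>In the lexicographic order on \<open>(a, b)\<close>, no later block covers the
  square \<open>(a, b + 1)\<close> with a nonzero entry.\<close>

lemma block_independent:
  assumes zero: "\<And>t. t \<in> board n \<Longrightarrow> (\<Sum>p\<in>board (n - 3). c p * block p t) = 0"
    and p: "p \<in> board (n - 3)"
  shows "c p = 0"
proof -
  have "(a, b) \<in> board (n - 3) \<Longrightarrow> c (a, b) = 0" for a b
  proof (induction a arbitrary: b rule: less_induct)
    case (less a)
    note rows = less.IH
    from less.prems show ?case
    proof (induction b rule: less_induct)
      case (less b)
      \<comment> \<open>Earlier blocks have coefficient 0, by the outer induction for smaller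
        \<open>a\<close> and the inner one for smaller \<open>b\<close>; later blocks vanish at the
        pivot \<open>(a, b + 1)\<close>.\<close>
      have "c p * block p (a, b + 1) = 0" if "p \<in> board (n - 3)" "p \<noteq> (a, b)" for p
      proof -
        obtain a' b' where p: "p = (a', b')" by fastforce
        have "a' < a \<or> a < a' \<or> a' = a \<and> b' < b \<or> a' = a \<and> b < b'"
          using that(2) p by auto
        then consider "a' < a" | "a < a'" | "a' = a" "b' < b" | "a' = a" "b < b'"
          by blast
        then show ?thesis
        proof cases
          case 2
          then show ?thesis using block_nonzero(1)[of a' b' a "b + 1"] p by force
        next
          case 3
          then show ?thesis using less.IH[of b'] that p by auto
        next
          case 4
          then show ?thesis by (simp add: p block_first_row)
        qed (use rows[of a' b'] that p in auto)
      qed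
      then have "(\<Sum>p\<in>board (n - 3) - {(a, b)}. c p * block p (a, b + 1)) = 0"
        by (intro sum.neutral) auto
      moreover have *: "(a, b + 1) \<in> board n" using less.prems by auto
      ultimately have "c (a, b) * block (a, b) (a, b + 1) = 0"
        using zero[OF *] less.prems
          sum.remove[of "board (n - 3)" "(a, b)" "\<lambda>p. c p * block p (a, b + 1)"] by auto
      then show ?case by (simp add: block_first_row)
    qed
  qed
  with p show ?thesis by (cases p) auto
qed

section \<open>The eigenspace for the eigenvalue -4\<close>

lemma sum_squares_nth:
  "(\<Sum>k<n\<^sup>2. h (squares n ! k)) = (\<Sum>t\<in>board n. h t)"
  by (rule sum.reindex_bij_betw)
    (auto intro!: bij_betw_nth simp: distinct_squares length_squares set_squares)

lemma squares_nth_mem: "k < n\<^sup>2 \<Longrightarrow> squares n ! k \<in> board n"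
  using nth_mem[of k "squares n"] by (simp add: length_squares set_squares)

lemma ex_squares_nth: "t \<in> board n \<Longrightarrow> \<exists>k<n\<^sup>2. squares n ! k = t"
  using set_squares[of n] by (metis in_set_conv_nth length_squares)

text \<open>Extending by 0 off the board is the normalisation that
  \<open>balanced_combination\<close> asks for.\<close>

lemma ex_board_vec:
  assumes v: "v \<in> carrier_vec (n\<^sup>2)"
  obtains f where "v = board_vec n f" "\<And>t. t \<notin> board n \<Longrightarrow> f t = 0"
proof
  let ?f = "\<lambda>t. \<Sum>k<n\<^sup>2. of_bool (squares n ! k = t) * v $ k"
  show "?f t = 0" if "t \<notin> board n" for t
    using that squares_nth_mem by (intro sum.neutral) fastforce
  have "?f (squares n ! k) = v $ k" if "k < n\<^sup>2" for k
  proof -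
    have "?f (squares n ! k) = (\<Sum>k'<n\<^sup>2. if k' = k then v $ k' else 0)"
      using that by (intro sum.cong)
        (auto simp: nth_eq_iff_index_eq[OF distinct_squares] length_squares)
    then show ?thesis using that by simp
  qed
  then show "v = board_vec n ?f"
    using v by (intro eq_vecI) (auto simp: board_vec_def)
qed

text \<open>Two distinct squares share at most one line, while a square shares all four lines with
  itself. This is the entrywise decomposition of the adjacency matrix plus \<open>4 I\<close> into
  line indicators.\<close>

lemma queens_adjacent_lines:
  "of_bool (queens_adjacent s t) + 4 * of_bool (s = t)
    = (\<Sum>l\<leftarrow>line_maps. of_bool (l t = l s) :: real)"
  by (cases s; cases t) (auto simp: queens_adjacent_def line_maps_def of_bool_def)

lemma queens_matrix_mult_index:
  assumes k: "k < n\<^sup>2"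
  shows "(queens_matrix n *\<^sub>v board_vec n f) $ k + 4 * board_vec n f $ k
    = (\<Sum>l\<leftarrow>line_maps. \<Sum>t\<in>board n. f t * of_bool (l t = l (squares n ! k)))"
proof -
  let ?s = "squares n ! k"
  have "(queens_matrix n *\<^sub>v board_vec n f) $ k
      = (\<Sum>k'<n\<^sup>2. of_bool (queens_adjacent ?s (squares n ! k')) * f (squares n ! k'))"
    using k by (simp add: queens_matrix_def board_vec_def scalar_prod_def atLeast0LessThan of_bool_def)
  also have "\<dots> = (\<Sum>t\<in>board n. of_bool (queens_adjacent ?s t) * f t)"
    by (rule sum_squares_nth)
  finally have "(queens_matrix n *\<^sub>v board_vec n f) $ k
      = (\<Sum>t\<in>board n. of_bool (queens_adjacent ?s t) * f t)" .
  moreover have "4 * board_vec n f $ k = (\<Sum>t\<in>board n. 4 * of_bool (?s = t) * f t)"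
  proof -
    have "(\<Sum>t\<in>board n. 4 * of_bool (?s = t) * f t) = (\<Sum>t\<in>board n. if ?s = t then 4 * f t else 0)"
      by (intro sum.cong) auto
    then show ?thesis using squares_nth_mem[OF k] k by (simp add: board_vec_def)
  qed
  ultimately have "(queens_matrix n *\<^sub>v board_vec n f) $ k + 4 * board_vec n f $ k
      = (\<Sum>t\<in>board n. (\<Sum>l\<leftarrow>line_maps. of_bool (l t = l ?s)) * f t)"
    unfolding queens_adjacent_lines[symmetric] distrib_right sum.distrib by simp
  also have "\<dots> = (\<Sum>l\<leftarrow>line_maps. \<Sum>t\<in>board n. f t * of_bool (l t = l ?s))"
    by (simp add: line_maps_def sum.distrib[symmetric] algebra_simps)
  finally show ?thesis .
qed

text \<open>Both sides add \<open>f s * f t\<close> over the pairs with \<open>l s = l t\<close>; on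
  the right the pairs are grouped by the common value. This exhibits the quadratic form of one
  direction as a sum of squares.\<close>

lemma sum_line_sums_squared:
  fixes f :: "'a \<Rightarrow> real" and l :: "'a \<Rightarrow> 'b"
  assumes "finite S"
  shows "(\<Sum>s\<in>S. f s * (\<Sum>t\<in>S. f t * of_bool (l t = l s)))
    = (\<Sum>k\<in>l ` S. (\<Sum>t\<in>S. f t * of_bool (l t = k))\<^sup>2)"
proof -
  have "(\<Sum>k\<in>l ` S. (\<Sum>t\<in>S. f t * of_bool (l t = k))\<^sup>2)
      = (\<Sum>k\<in>l ` S. \<Sum>s\<in>S. \<Sum>t\<in>S. f s * of_bool (l s = k) * (f t * of_bool (l t = k)))"
    by (simp add: power2_eq_square sum_product)
  also have "\<dots> = (\<Sum>s\<in>S. \<Sum>t\<in>S. \<Sum>k\<in>l ` S. f s * of_bool (l s = k) * (f t * of_bool (l t = k)))"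
    by (subst sum.swap) (intro sum.cong refl sum.swap)
  also have "\<dots> = (\<Sum>s\<in>S. \<Sum>t\<in>S. f s * (f t * of_bool (l t = l s)))"
  proof (intro sum.cong refl)
    fix s t assume "s \<in> S" "t \<in> S"
    have "(\<Sum>k\<in>l ` S. f s * of_bool (l s = k) * (f t * of_bool (l t = k)))
        = (\<Sum>k\<in>l ` S. if k = l s then f s * (f t * of_bool (l t = l s)) else 0)"
      by (intro sum.cong) auto
    then show "(\<Sum>k\<in>l ` S. f s * of_bool (l s = k) * (f t * of_bool (l t = k)))
        = f s * (f t * of_bool (l t = l s))"
      using \<open>s \<in> S\<close> assms by simp
  qed
  finally show ?thesis by (simp add: sum_distrib_left)
qed

lemma queens_matrix_carrier: "queens_matrix n \<in> carrier_mat (n\<^sup>2) (n\<^sup>2)"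
  by (simp add: queens_matrix_def)

text \<open>Pairing \<open>(A + 4 I) f = 0\<close> with \<open>f\<close> gives a vanishing sum of
  squared line sums, so every line sum is 0. Conversely, each coordinate of
  \<open>(A + 4 I) f\<close> is a sum of four line sums.\<close>

lemma eigenspace_queens_iff_balanced:
  "board_vec n f \<in> eigenspace (queens_matrix n) (-4) \<longleftrightarrow> balanced n f"
proof -
  let ?L = "\<lambda>l k. \<Sum>t\<in>board n. f t * of_bool (l t = k)"
  have "board_vec n f \<in> eigenspace (queens_matrix n) (-4)
      \<longleftrightarrow> (\<forall>k<n\<^sup>2. (queens_matrix n *\<^sub>v board_vec n f) $ k + 4 * board_vec n f $ k = 0)"
  proof -
    have dims: "dim_row (queens_matrix n) = n\<^sup>2" "dim_vec (board_vec n f) = n\<^sup>2"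
      by (simp_all add: queens_matrix_def board_vec_def)
    have "board_vec n f \<in> eigenspace (queens_matrix n) (-4)
        \<longleftrightarrow> queens_matrix n *\<^sub>v board_vec n f = (- 4) \<cdot>\<^sub>v board_vec n f"
      unfolding eigenspace_def mem_Collect_eq using dims by (metis carrier_vecI)
    also have "\<dots> \<longleftrightarrow> (\<forall>k<n\<^sup>2. (queens_matrix n *\<^sub>v board_vec n f) $ k = - 4 * board_vec n f $ k)"
      unfolding vec_eq_iff by (simp only: dims dim_mult_mat_vec index_smult_vec simp_thms cong: imp_cong)
    also have "\<dots> \<longleftrightarrow> (\<forall>k<n\<^sup>2. (queens_matrix n *\<^sub>v board_vec n f) $ k + 4 * board_vec n f $ k = 0)"
      by (simp only: eq_neg_iff_add_eq_0 mult_minus_left)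
    finally show ?thesis .
  qed
  also have "\<dots> \<longleftrightarrow> (\<forall>s\<in>board n. (\<Sum>l\<leftarrow>line_maps. ?L l (l s)) = 0)"
  proof -
    have "(\<forall>k<n\<^sup>2. P (squares n ! k)) \<longleftrightarrow> (\<forall>s\<in>board n. P s)" for P
      by (metis squares_nth_mem ex_squares_nth)
    from this[of "\<lambda>s. (\<Sum>l\<leftarrow>line_maps. ?L l (l s)) = 0"] show ?thesis
      by (simp only: queens_matrix_mult_index cong: imp_cong)
  qed
  also have "\<dots> \<longleftrightarrow> balanced n f"
  proof
    assume "\<forall>s\<in>board n. (\<Sum>l\<leftarrow>line_maps. ?L l (l s)) = 0"
    then have "0 = (\<Sum>s\<in>board n. f s * (\<Sum>l\<leftarrow>line_maps. ?L l (l s)))"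
      by (intro sum.neutral[symmetric] ballI) (simp only: mult_zero_right)
    also have "\<dots> = (\<Sum>l\<leftarrow>line_maps. \<Sum>s\<in>board n. f s * ?L l (l s))"
    proof -
      have "(\<Sum>s\<in>S. f s * (\<Sum>l\<leftarrow>ls. h l s)) = (\<Sum>l\<leftarrow>ls. \<Sum>s\<in>S. f s * h l s)"
        for S and ls :: "(square \<Rightarrow> int) list" and h
        by (induction ls) (simp_all add: sum.distrib distrib_left)
      then show ?thesis .
    qed
    also have "\<dots> = (\<Sum>l\<leftarrow>line_maps. \<Sum>k\<in>l ` board n. (?L l k)\<^sup>2)"
      by (simp only: sum_line_sums_squared finite_cartesian_product finite_atLeastAtMost)
    finally have total: "(\<Sum>l\<leftarrow>line_maps. \<Sum>k\<in>l ` board n. (?L l k)\<^sup>2) = 0"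
      by (rule sym)
    have nonneg: "h l = 0" if "(\<Sum>l\<leftarrow>ls. h l) = 0" "l \<in> set ls" "\<And>l. 0 \<le> h l"
      for l ls and h :: "(square \<Rightarrow> int) \<Rightarrow> real"
      using that sum_list_nonneg_eq_0_iff[of "map h ls"] by auto
    have squares: "(\<Sum>k\<in>l ` board n. (?L l k)\<^sup>2) = 0" if "l \<in> set line_maps" for l
      by (rule nonneg[OF total that]) (intro sum_nonneg zero_le_power2)
    have on: "?L l k = 0" if "l \<in> set line_maps" "k \<in> l ` board n" for l k
    proof -
      have "finite (l ` board n)" by simp
      from sum_nonneg_0[OF this _ squares[OF that(1)] that(2)] show ?thesis
        by (simp only: zero_le_power2 power_eq_0_iff)
    qed
    \<comment> \<open>The sum of squares covers only values taken on the board; for any other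
      \<open>k\<close> all terms are 0.\<close>
    have "?L l k = 0" if "l \<in> set line_maps" for l k
    proof (cases "k \<in> l ` board n")
      case False
      then have "f t * of_bool (l t = k) = 0" if "t \<in> board n" for t
        using that by auto
      then show ?thesis by (intro sum.neutral) blast
    qed (use on that in blast)
    then show "balanced n f" unfolding balanced_def by blast
  next
    assume bal: "balanced n f"
    show "\<forall>s\<in>board n. (\<Sum>l\<leftarrow>line_maps. ?L l (l s)) = 0"
    proof
      fix s
      have "map (\<lambda>l. ?L l (l s)) line_maps = map (\<lambda>_. 0) line_maps"
        using bal unfolding balanced_def by (intro map_cong refl) blast
      then show "(\<Sum>l\<leftarrow>line_maps. ?L l (l s)) = 0" by (simp only: sum_list_0)
    qed
  qed
  finally show ?thesis .
qed

section \<open>Multiplicities for real symmetric matrices\<close>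

text \<open>The polynomial splits over the complex numbers, symmetry of the real matrix makes every
  root real, and the factorization descends because the embedding of real polynomials is
  injective.\<close>

lemma symmetric_char_poly_splits:
  fixes A :: "real mat"
  assumes A: "A \<in> carrier_mat n n" and sym: "transpose_mat A = A"
  shows "\<exists>as. char_poly A = (\<Prod>a\<leftarrow>as. [:- a, 1:])"
proof -
  let ?h = "of_real :: real \<Rightarrow> complex"
  interpret p: map_poly_inj_comm_ring_hom ?h ..
  define C where "C = map_mat ?h A"
  have C: "C \<in> carrier_mat n n" using A by (simp add: C_def)
  have symC: "transpose_mat C = C" unfolding C_def
    using sym by (metis map_mat_transpose)
  have conjC: "conjugate (C *\<^sub>v v) = C *\<^sub>v conjugate v" if "v \<in> carrier_vec n" for v
    using A that by (intro eq_vecI) (auto simp: C_def scalar_prod_def)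
  obtain as where as: "char_poly C = (\<Prod>a\<leftarrow>as. [:- a, 1:])"
    using char_poly_factorized[OF C] by blast
  have real: "?h (Re a) = a" if "a \<in> set as" for a
  proof -
    have "poly (char_poly C) a = 0"
      using that unfolding as by (force simp: poly_prod_list)
    then obtain v where v: "v \<in> carrier_vec n" "v \<noteq> 0\<^sub>v n" "C *\<^sub>v v = a \<cdot>\<^sub>v v"
      using eigenvalue_root_char_poly[OF C] C by (auto simp: eigenvalue_def eigenvector_def)
    \<comment> \<open>The Hermitian form of \<open>C\<close> at the eigenvector \<open>v\<close> is
      evaluated in two ways; \<open>v \<bullet>c v\<close> is nonzero and can be cancelled.\<close>
    have "cnj a * (v \<bullet>c v) = v \<bullet> conjugate (C *\<^sub>v v)"
      using v by (simp add: conjugate_smult_vec)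
    also have "\<dots> = (C *\<^sub>v v) \<bullet>c v"
      using transpose_vec_mult_scalar[OF C _ v(1), of "conjugate v"] v(1)
      by (simp only: conjC[OF v(1)] symC carrier_vec_conjugate)
    also have "\<dots> = a * (v \<bullet>c v)"
      using v by simp
    finally have "cnj a = a"
      using conjugate_square_eq_0_vec[of v n] v by simp
    then show ?thesis by (simp add: complex_eq_iff)
  qed
  have "map_poly ?h (char_poly A) = (\<Prod>a\<leftarrow>as. [:- a, 1:])"
    using of_real_hom.char_poly_hom[OF A, where ?'a = complex] as unfolding C_def by metis
  also have "\<dots> = (\<Prod>a\<leftarrow>as. map_poly ?h [:- Re a, 1:])"
    using real by (intro arg_cong[where f = prod_list] map_cong) (auto simp: of_real_hom.map_poly_pCons_hom)
  also have "\<dots> = map_poly ?h (\<Prod>a\<leftarrow>map Re as. [:- a, 1:])"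
    by (simp add: p.hom_prod_list o_def)
  finally have "char_poly A = (\<Prod>a\<leftarrow>map Re as. [:- a, 1:])" by simp
  then show ?thesis by blast
qed

text \<open>If \<open>B\<close> kills \<open>B v\<close>, then by symmetry the squared norm of
  \<open>B v\<close> is the product of \<open>v\<close> with \<open>B (B v) = 0\<close>.\<close>

lemma mat_kernel_symmetric_square:
  fixes B :: "real mat"
  assumes B: "B \<in> carrier_mat n n" and sym: "transpose_mat B = B"
  shows "mat_kernel (B * B) = mat_kernel B"
proof
  show "mat_kernel B \<subseteq> mat_kernel (B * B)"
    by (rule mat_kernel_mult_subset[OF B B])
  show "mat_kernel (B * B) \<subseteq> mat_kernel B"
  proof
    fix v assume "v \<in> mat_kernel (B * B)"
    then have v: "v \<in> carrier_vec n" and BBv: "B *\<^sub>v (B *\<^sub>v v) = 0\<^sub>v n"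
      using B by (auto simp: mat_kernel_def)
    have "(B *\<^sub>v v) \<bullet>c (B *\<^sub>v v) = (B *\<^sub>v v) \<bullet> (B *\<^sub>v v)"
      by (intro arg_cong2[where f = "(\<bullet>)"]) auto
    also have "\<dots> = v \<bullet> (B *\<^sub>v (B *\<^sub>v v))"
      using transpose_vec_mult_scalar[OF B v, of "B *\<^sub>v v"] B v
        comm_scalar_prod[of v n "B *\<^sub>v (B *\<^sub>v v)"] by (simp add: sym)
    also have "\<dots> = 0" using v by (simp add: BBv)
    finally have "B *\<^sub>v v = 0\<^sub>v n"
      using conjugate_square_eq_0_vec[of "B *\<^sub>v v" n] B v by simp
    then show "v \<in> mat_kernel B" by (rule mat_kernelI[OF B v])
  qed
qed

text \<open>The kernel of the k-th power of \<open>char_matrix A c\<close> has as dimension the sum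
  of \<open>min k m\<close> over the sizes \<open>m\<close> of the Jordan blocks at
  \<open>c\<close>. Equality for k = 1 and k = 2 forces all sizes to be at most 1, so the sum of the
  sizes (the order of the root) is the dimension of the kernel.\<close>

lemma symmetric_order_char_poly:
  fixes A :: "real mat"
  assumes A: "A \<in> carrier_mat n n" and sym: "transpose_mat A = A"
  shows "Polynomial.order c (char_poly A) = kernel_dim (char_matrix A c)"
proof -
  let ?B = "char_matrix A c"
  have B: "?B \<in> carrier_mat n n" using A by simp
  have symB: "transpose_mat ?B = ?B"
    using A sym unfolding char_matrix_def by (subst transpose_add[of _ n n]) auto
  obtain n_as where jnf: "jordan_nf A n_as"
    using symmetric_char_poly_splits[OF A sym] jordan_nf_exists[OF A] by blast
  define ns where "ns = map fst [(m, e)\<leftarrow>n_as . e = c]"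
  have "kernel_dim (?B ^\<^sub>m 2) = kernel_dim (?B ^\<^sub>m 1)"
    using B mat_kernel_symmetric_square[OF B symB] by (simp add: kernel_dim_def numeral_2_eq_2)
  then have "(\<Sum>m\<leftarrow>ns. min 2 m) = (\<Sum>m\<leftarrow>ns. min 1 m)"
    using dim_gen_eigenspace[OF jnf, of c 2] dim_gen_eigenspace[OF jnf, of c 1]
    by (simp add: dim_gen_eigenspace_def ns_def)
  \<comment> \<open>The weak inequality in the first alternative is there for the induction: it lets
    a new size of at least 2 yield the strict alternative.\<close>
  moreover have "(\<Sum>m\<leftarrow>ms. min 1 m) = sum_list ms \<and> (\<Sum>m\<leftarrow>ms. min 1 m) \<le> (\<Sum>m\<leftarrow>ms. min 2 m)
      \<or> (\<Sum>m\<leftarrow>ms. min 1 m) < (\<Sum>m\<leftarrow>ms. min 2 m)" for ms :: "nat list"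
    by (induction ms) auto
  ultimately have "sum_list ns = (\<Sum>m\<leftarrow>ns. min 1 m)"
    by (metis less_irrefl)
  also have "\<dots> = kernel_dim (?B ^\<^sub>m 1)"
    using dim_gen_eigenspace[OF jnf, of c 1] by (simp add: dim_gen_eigenspace_def ns_def)
  also have "\<dots> = kernel_dim ?B"
    using B by simp
  finally show ?thesis
    unfolding jordan_nf_order[OF jnf] ns_def by (simp add: case_prod_unfold)
qed

lemma eigenspace_eq_mat_kernel:
  assumes A: "A \<in> carrier_mat n n"
  shows "eigenspace A c = mat_kernel (char_matrix A c)"
proof -
  have "A *\<^sub>v v = c \<cdot>\<^sub>v v \<longleftrightarrow> char_matrix A c *\<^sub>v v = 0\<^sub>v n" if v: "v \<in> carrier_vec n" for v
  proof -
    have "char_matrix A c *\<^sub>v v = A *\<^sub>v v + (- c) \<cdot>\<^sub>v v"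
      unfolding char_matrix_def using A v by (subst add_mult_distrib_mat_vec[of _ n n]) auto
    then show ?thesis using A v by (auto simp: vec_eq_iff)
  qed
  then show ?thesis
    using A by (auto simp: eigenspace_def mat_kernel_def char_matrix_def)
qed

section \<open>The basis of blocks\<close>

lemma X_index: "k < n\<^sup>2 \<Longrightarrow> X n p $ k = block p (squares n ! k)"
  by (simp add: X_eq_block board_vec_def)

lemma X_carrier: "X n p \<in> carrier_vec (n\<^sup>2)"
  by (simp add: X_eq_block board_vec_def)

lemma inj_on_X: "inj_on (X n) (board (n - 3))"
proof (rule inj_onI, rule ccontr)
  fix p q assume p: "p \<in> board (n - 3)" and q: "q \<in> board (n - 3)"
    and eq: "X n p = X n q" and ne: "p \<noteq> q"
  \<comment> \<open>Equal vectors at distinct \<open>p\<close> and \<open>q\<close> would give the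
    linear relation with coefficients 1 and -1.\<close>
  define c :: "square \<Rightarrow> real" where "c r = (if r = p then 1 else 0) - (if r = q then 1 else 0)" for r
  have "c p = 0"
  proof (rule block_independent[of n])
    fix t assume "t \<in> board n"
    then obtain k where k: "k < n\<^sup>2" "squares n ! k = t"
      using ex_squares_nth by blast
    have "(\<Sum>r\<in>board (n - 3). c r * block r t)
        = (\<Sum>r\<in>board (n - 3). if r = p then block r t else 0)
          - (\<Sum>r\<in>board (n - 3). if r = q then block r t else 0)"
      unfolding sum_subtractf[symmetric] c_def by (intro sum.cong) auto
    also have "\<dots> = block p t - block q t"
      using p q by simp
    also have "\<dots> = 0"
      using k X_index[of k n p] X_index[of k n q] eq by simp
    finally show "(\<Sum>r\<in>board (n - 3). c r * block r t) = 0" .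
  qed (rule p)
  with ne show False by (simp add: c_def)
qed

text \<open>The eigenspace is a matrix kernel, so the \<open>kernel\<close> locale supplies its span
  and independence. In coordinates, independence is \<open>block_independent\<close> and spanning is
  \<open>balanced_combination\<close> started at \<open>m = 0\<close>.\<close>

lemma X_basis:
  assumes n: "4 \<le> n"
  shows "vectorspace.basis class_ring (eigenspace_module (queens_matrix n) (-4))
    (X n ` board (n - 3))"
proof -
  let ?A = "queens_matrix n" and ?P = "board (n - 3)"
  have car: "?A \<in> carrier_mat (n\<^sup>2) (n\<^sup>2)" by (rule queens_matrix_carrier)
  have row: "dim_row ?A = n\<^sup>2" using car by simp
  interpret kernel "n\<^sup>2" "n\<^sup>2" "char_matrix ?A (-4)"
    by unfold_locales (use car in simp)
  have eig: "eigenspace ?A (-4) = mat_kernel (char_matrix ?A (-4))"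
    by (rule eigenspace_eq_mat_kernel[OF car])
  have sub: "X n ` ?P \<subseteq> mat_kernel (char_matrix ?A (-4))"
  proof
    fix v assume "v \<in> X n ` ?P"
    then show "v \<in> mat_kernel (char_matrix ?A (-4))"
      unfolding X_eq_block eig[symmetric]
      by (auto simp: eigenspace_queens_iff_balanced simp del: atLeastAtMost_iff intro!: balanced_block)
  qed
  have lincomb_X: "lincomb a (X n ` ?P) $ k = (\<Sum>p\<in>?P. a (X n p) * block p (squares n ! k))"
    if k: "k < n\<^sup>2" for a k
    unfolding lincomb_index[OF k sub]
    using inj_on_X[of n] by (subst sum.reindex) (auto simp: X_index[OF k])
  have indpt: "lin_indpt (X n ` ?P)"
  proof (rule Ker.finite_lin_indpt2)
    fix a assume zero: "lincomb a (X n ` ?P) = 0\<^sub>v (n\<^sup>2)"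
    have "a (X n p) = 0" if "p \<in> ?P" for p
    proof (rule block_independent[of n "\<lambda>p. a (X n p)", OF _ that])
      fix t assume "t \<in> board n"
      then obtain k where k: "k < n\<^sup>2" "squares n ! k = t"
        using ex_squares_nth by blast
      then show "(\<Sum>p\<in>?P. a (X n p) * block p t) = 0"
        using lincomb_X[OF k(1), of a] zero by simp
    qed
    then show "\<forall>v\<in>X n ` ?P. a v = 0" by blast
  qed (use sub in auto)
  have "v \<in> span (X n ` ?P)" if v: "v \<in> mat_kernel (char_matrix ?A (-4))" for v
  proof -
    have vc: "v \<in> carrier_vec (n\<^sup>2)"
      using mat_kernelD(1)[OF _ v] A by (metis char_matrix_closed)
    obtain f where f: "v = board_vec n f" "\<And>t. t \<notin> board n \<Longrightarrow> f t = 0"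
      using ex_board_vec[OF vc] by blast
    have bal: "balanced n f"
      using v unfolding eig[symmetric] f(1) eigenspace_queens_iff_balanced .
    \<comment> \<open>Rows are numbered from 1, so row 0 is off the board and the elimination starts
      with no row cleared.\<close>
    have row0: "f (0, j) = 0" for j by (rule f(2)) auto
    obtain c where c: "f t = (\<Sum>p\<in>?P. c p * block p t)" for t
      using balanced_combination[OF bal n f(2), of 0] row0 by auto
    \<comment> \<open>\<open>lincomb\<close> takes coefficients indexed by vectors, so
      \<open>c\<close> is transported along the injection \<open>X n\<close>.\<close>
    define a where "a w = c (the_inv_into ?P (X n) w)" for w
    have a: "a (X n p) = c p" if "p \<in> ?P" for p
      using the_inv_into_f_f[OF inj_on_X that] by (simp add: a_def)
    have "v $ k = lincomb a (X n ` ?P) $ k" if k: "k < n\<^sup>2" for k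
      unfolding lincomb_X[OF k] using k by (simp add: f(1) board_vec_def c a)
    moreover have "dim_vec (lincomb a (X n ` ?P)) = n\<^sup>2"
      unfolding lincomb_same[OF sub] by (rule NC.lincomb_dim) (auto intro: X_carrier)
    ultimately have "v = lincomb a (X n ` ?P)"
      using vc by (intro eq_vecI) auto
    then show ?thesis unfolding Ker.span_def by blast
  qed
  moreover have "span (X n ` ?P) \<subseteq> mat_kernel (char_matrix ?A (-4))"
    using Ker.span_is_subset2[OF sub] by simp
  ultimately have "span (X n ` ?P) = mat_kernel (char_matrix ?A (-4))"
    by blast
  then have "basis (X n ` ?P)"
    unfolding Ker.basis_def using indpt sub by blast
  then show ?thesis by (simp only: eig row)
qed

theorem theorem9:
  fixes n :: nat
  assumes "n \<ge> 4"
  shows "eigenvalue (queens_matrix n) (-4)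
    \<and> Polynomial.order (-4) (char_poly (queens_matrix n)) = (n - 3)\<^sup>2
    \<and> vectorspace.dim class_ring (eigenspace_module (queens_matrix n) (-4)) = (n - 3)\<^sup>2
    \<and> inj_on (X n) ({1..n - 3} \<times> {1..n - 3})
    \<and> vectorspace.basis class_ring (eigenspace_module (queens_matrix n) (-4))
        (X n ` ({1..n - 3} \<times> {1..n - 3}))"
proof -
  let ?A = "queens_matrix n" and ?P = "board (n - 3)"
  have car: "?A \<in> carrier_mat (n\<^sup>2) (n\<^sup>2)" by (rule queens_matrix_carrier)
  have basis: "vectorspace.basis class_ring (eigenspace_module ?A (-4)) (X n ` ?P)"
    by (rule X_basis[OF assms])
  have "card (X n ` ?P) = (n - 3)\<^sup>2"
    using card_image[OF inj_on_X] by (simp add: power2_eq_square)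
  then have dim: "vectorspace.dim class_ring (eigenspace_module ?A (-4)) = (n - 3)\<^sup>2"
    using vectorspace.dim_basis[OF vectorspace_eigenspace[OF car] _ basis] by simp
  have sym: "transpose_mat ?A = ?A"
    by (rule eq_matI) (auto simp: queens_matrix_def queens_adjacent_def split: prod.splits)
  have row: "dim_row ?A = n\<^sup>2" using car by simp
  interpret kernel "n\<^sup>2" "n\<^sup>2" "char_matrix ?A (-4)"
    by unfold_locales (use car in simp)
  have order: "Polynomial.order (-4) (char_poly ?A) = (n - 3)\<^sup>2"
    using dim unfolding symmetric_order_char_poly[OF car sym] kernel_dim
    by (simp only: eigenspace_eq_mat_kernel[OF car] row)
  \<comment> \<open>From \<open>n \<ge> 4\<close> the order \<open>(n - 3)^2\<close> is positive,
    whereas it would be 0 if -4 were not a root.\<close>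
  then have "poly (char_poly ?A) (-4) = 0"
    using assms order_0I[of "char_poly ?A" "-4"] by fastforce
  then have "eigenvalue ?A (-4)"
    using eigenvalue_root_char_poly[OF car] by blast
  with order dim inj_on_X basis show ?thesis by blast
qed

end
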